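(* Let $w,b,c:(0,t_1)\to\mathbb C$ be a solution of the hyperboloid system of ODEs (circular control, given in the context) with $c(t)\neq0$ for all $t\in(0,t_1)$, which extends continuously to $w(0)=b(0)=c(0)=0$ at $t=0$. Then the ODEs and solutions $w,b,c$ satisfy the estimates $$w'=-i\rho\frac{c}{|c|}+O(|w|),\qquad b'=2iw+O(|b|),\qquad c'=-3ib+O(|c|+|bw^2|+|b|^2|w|),$$ $$|w|=O(t),\quad|b|=O(t^2),\quad|c|=O(t^3),\quad|c|+|bw^2|+|b|^2|w|=O(t^3).$$
   Context: For complex $a$ put $[\![a]\!]=\sqrt{1+|a|^2}$; for $a_1,a_2\in\mathbb C$ put $\mathrm{Re}(a_1,a_2)=\mathrm{Re}(\bar a_1a_2)$. Fix a real constant $\rho>0$ (control parameter) and put $\mu(w,z)=[\![w]\!]-\rho\,\mathrm{Re}(w,z)$. Constants and assumptions: $\lambda_{cost}=-1$, $d_1=3/2$, $\epsilon=1$ (values at the singular locus). The hyperboloid system is $$w'=i\,\frac{w-\rho[\![w]\!]z^*}{\mu(w,z^* )},\qquad b'=2i\big([\![b]\!]w+b[\![w]\!]\big),$$ $$c'=\frac{i(1-\rho^2)\,\mathrm{Re}(c\,\xi_0,z^* )}{2[\![w]\!]\,\mu(w,z^* )^2}\,z^*-i\big((3[\![b]\!]-3)w+3b[\![w]\!]\big),$$ where $\xi_0=2+|w|^2-(w\bar c/|c|)^2$, and $z^*$ (with $|z^*|=1$) is the optimal control $$z^*=\frac{c}{|c|}\cdot\frac{\xi_1+\sqrt{\Delta}}{2\bar\xi_0},\qquad\tilde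 w=\frac{\bar cw}{|c|},\quad\xi_1=2\rho(\tilde w-\bar{\tilde w})[\![\tilde w]\!],\quad\Delta=\xi_1^2+4|\xi_0|^2>0.$$ It is assumed that $\mu(w,z^* )>0$ along the solution, and that the conserved quantities have the values they take at the singular locus: the Hamiltonian $\mathcal H=3\,\mathrm{Re}(w,b)+(3[\![b]\!]-3)[\![w]\!]-\frac{\mathrm{Re}(w-\rho[\![w]\!]z^*,c)}{\mu(w,z^* )[\![w]\!]}$ equals $0$, and the angular momentum $\mathcal A=3[\![b]\!]-2\,\mathrm{Re}(w,c)/[\![w]\!]$ equals $3$. $f_1=f_2+O(f_3)$ means that there exist $t_2>0$ and $C>0$ such that $|f_1(t)-f_2(t)|\le C|f_3(t)|$ for all $t\in(0,t_2)$. *)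

theory Defs
  imports "HOL-Analysis.Analysis" "HOL-Library.Landau_Symbols"
begin

definition jbracket :: "complex \<Rightarrow> real" where
  "jbracket a = sqrt (1 + (cmod a)\<^sup>2)"

definition re_pair :: "complex \<Rightarrow> complex \<Rightarrow> real" where
  "re_pair a1 a2 = Re (cnj a1 * a2)"

definition mu :: "real \<Rightarrow> complex \<Rightarrow> complex \<Rightarrow> real" where
  "mu \<rho> w z = jbracket w - \<rho> * re_pair w z"

definition wtilde :: "complex \<Rightarrow> complex \<Rightarrow> complex" where
  "wtilde w c = cnj c * w / of_real (cmod c)"

definition xi0 :: "complex \<Rightarrow> complex \<Rightarrow> complex" where
  "xi0 w c = 2 + of_real ((cmod w)\<^sup>2) - (w * cnj c / of_real (cmod c))\<^sup>2"

definition xi1 :: "real \<Rightarrow> complex \<Rightarrow> complex \<Rightarrow> complex" where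
  "xi1 \<rho> w c =
     2 * of_real \<rho> * (wtilde w c - cnj (wtilde w c)) * of_real (jbracket (wtilde w c))"

text \<open>Since \<open>xi1\<close> is purely imaginary, its square is real and the discriminant
  \<open>xi1\<^sup>2 + 4 |xi0|\<^sup>2\<close> is a real number, possibly negative if \<open>\<rho> > 1\<close>;
  see \<open>of_real_Delta\<close> below.\<close>

definition Delta :: "real \<Rightarrow> complex \<Rightarrow> complex \<Rightarrow> real" where
  "Delta \<rho> w c = Re ((xi1 \<rho> w c)\<^sup>2) + 4 * (cmod (xi0 w c))\<^sup>2"

definition zstar :: "real \<Rightarrow> complex \<Rightarrow> complex \<Rightarrow> complex" where
  "zstar \<rho> w c =
     c / of_real (cmod c) *
     ((xi1 \<rho> w c + of_real (sqrt (Delta \<rho> w c))) / (2 * cnj (xi0 w c)))"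

definition w_rhs :: "real \<Rightarrow> complex \<Rightarrow> complex \<Rightarrow> complex" where
  "w_rhs \<rho> w c =
     \<i> * ((w - of_real (\<rho> * jbracket w) * zstar \<rho> w c) / of_real (mu \<rho> w (zstar \<rho> w c)))"

definition b_rhs :: "complex \<Rightarrow> complex \<Rightarrow> complex" where
  "b_rhs w b = 2 * \<i> * (of_real (jbracket b) * w + b * of_real (jbracket w))"

definition c_rhs :: "real \<Rightarrow> complex \<Rightarrow> complex \<Rightarrow> complex \<Rightarrow> complex" where
  "c_rhs \<rho> w b c =
     \<i> * of_real ((1 - \<rho>\<^sup>2) * re_pair (c * xi0 w c) (zstar \<rho> w c)) /
       of_real (2 * jbracket w * (mu \<rho> w (zstar \<rho> w c))\<^sup>2) * zstar \<rho> w c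
     - \<i> * (of_real (3 * jbracket b - 3) * w + 3 * b * of_real (jbracket w))"

definition hamiltonian :: "real \<Rightarrow> complex \<Rightarrow> complex \<Rightarrow> complex \<Rightarrow> real" where
  "hamiltonian \<rho> w b c =
     3 * re_pair w b + (3 * jbracket b - 3) * jbracket w
     - re_pair (w - of_real (\<rho> * jbracket w) * zstar \<rho> w c) c /
       (mu \<rho> w (zstar \<rho> w c) * jbracket w)"

definition angular_momentum :: "complex \<Rightarrow> complex \<Rightarrow> complex \<Rightarrow> real" where
  "angular_momentum w b c = 3 * jbracket b - 2 * re_pair w c / jbracket w"

text \<open>\<open>eq_upto_O f1 f2 f3\<close> means \<open>f1 = f2 + O(f3)\<close> as the argument tends to 0 from the right.
  It allows \<open>f1\<close>, \<open>f2\<close> and \<open>f3\<close> to take values in different normed spaces, unlike the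
  Landau symbols; see \<open>eq_upto_O_iff_bigo\<close> for the relation.\<close>

definition eq_upto_O ::
  "(real \<Rightarrow> 'a::real_normed_vector) \<Rightarrow> (real \<Rightarrow> 'a) \<Rightarrow> (real \<Rightarrow> real) \<Rightarrow> bool" where
  "eq_upto_O f1 f2 f3 \<longleftrightarrow>
     (\<exists>t2>0. \<exists>C>0. \<forall>t\<in>{0<..<t2}. norm (f1 t - f2 t) \<le> C * \<bar>f3 t\<bar>)"

lemma eq_upto_O_iff_bigo:
  "eq_upto_O f1 f2 f3 \<longleftrightarrow> (\<lambda>t. norm (f1 t - f2 t)) \<in> O[at_right 0](f3)"
  unfolding eq_upto_O_def bigo_def eventually_at_right_field
  by (simp add: Ball_def) blast

lemma of_real_Delta:
  "complex_of_real (Delta \<rho> w c) =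
     (xi1 \<rho> w c)\<^sup>2 + 4 * of_real ((cmod (xi0 w c))\<^sup>2)"
  by (simp add: complex_eq_iff Delta_def xi1_def power2_eq_square)

lemma xi0_nonzero:
  assumes "c \<noteq> 0"
  shows "xi0 w c \<noteq> 0"
proof
  assume "xi0 w c = 0"
  then have "(w * cnj c / of_real (cmod c))\<^sup>2 = of_real (2 + (cmod w)\<^sup>2)"
    by (simp add: xi0_def)
  then have "cmod ((w * cnj c / of_real (cmod c))\<^sup>2) = 2 + (cmod w)\<^sup>2"
    by (metis abs_of_nonneg add_nonneg_nonneg norm_of_real zero_le_numeral zero_le_power2)
  moreover have "cmod ((w * cnj c / of_real (cmod c))\<^sup>2) = (cmod w)\<^sup>2"
    using assms by (simp add: norm_power norm_mult norm_divide)
  ultimately show False by simp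
qed

lemma norm_zstar:
  assumes "c \<noteq> 0" "Delta \<rho> w c > 0"
  shows "cmod (zstar \<rho> w c) = 1"
proof -
  have re: "Re (xi1 \<rho> w c) = 0"
    by (simp add: xi1_def)
  have "(cmod (xi1 \<rho> w c + of_real (sqrt (Delta \<rho> w c))))\<^sup>2 =
      (Im (xi1 \<rho> w c))\<^sup>2 + Delta \<rho> w c"
    using re assms by (simp add: cmod_power2)
  also have "\<dots> = (2 * cmod (xi0 w c))\<^sup>2"
    using re by (simp add: Delta_def power2_eq_square)
  finally have "cmod (xi1 \<rho> w c + of_real (sqrt (Delta \<rho> w c))) = 2 * cmod (xi0 w c)"
    by (rule power2_eq_imp_eq) auto
  then show ?thesis
    using assms xi0_nonzero[of c w] by (simp add: zstar_def norm_mult norm_divide)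
qed

end

theory Submission
  imports Defs
begin

text \<open>For small \<open>w\<close> the control \<open>z\<^sup>*\<close> differs from \<open>c/|c|\<close> by \<open>O(|w|)\<close>, because
  \<open>\<xi>\<^sub>0 = 2 + O(|w|\<^sup>2)\<close> and \<open>\<xi>\<^sub>1 = O(|w|)\<close>; inserting this into the right-hand sides gives the
  estimates of the derivatives. The growth rates follow by bootstrapping with the mean value
  inequality: \<open>w'\<close> is bounded, so \<open>w = O(t)\<close>; then \<open>b = O(t\<^sup>n)\<close> implies \<open>b = O(t\<^bsup>n+1\<^esup>)\<close> for \<open>n \<le> 1\<close>,
  and \<open>c = O(t\<^sup>n)\<close> implies \<open>c = O(t\<^bsup>n+1\<^esup>)\<close> for \<open>n \<le> 2\<close>.\<close>

section \<open>Elementary bounds on the bracket, the pairing and the ingredients of the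
  control\<close>

lemma jbracket_ge_1: "1 \<le> jbracket a"
  by (simp add: jbracket_def)

lemma jbracket_le: "jbracket a \<le> 1 + (cmod a)\<^sup>2 / 2"
  unfolding jbracket_def by (rule real_le_lsqrt) (auto simp: power2_eq_square algebra_simps)

text \<open>Linear form of the quadratic bound, for places where errors are measured to first
  order.\<close>

lemma jbracket_minus_1_le:
  assumes "cmod a \<le> 1"
  shows "jbracket a - 1 \<le> cmod a / 2"
proof -
  have "(cmod a)\<^sup>2 \<le> cmod a * 1"
    unfolding power2_eq_square using assms by (intro mult_left_mono) auto
  then show ?thesis
    using jbracket_le[of a] by simp
qed

lemma abs_re_pair_le: "\<bar>re_pair a b\<bar> \<le> cmod a * cmod b"
  unfolding re_pair_def using abs_Re_le_cmod[of "cnj a * b"] by (simp add: norm_mult)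

lemma norm_wtilde: "c \<noteq> 0 \<Longrightarrow> cmod (wtilde w c) = cmod w"
  by (simp add: wtilde_def norm_mult norm_divide)

lemma norm_xi0_minus_2_le:
  assumes "c \<noteq> 0"
  shows "cmod (xi0 w c - 2) \<le> 2 * (cmod w)\<^sup>2"
proof -
  have "xi0 w c - 2 = of_real ((cmod w)\<^sup>2) - (wtilde w c)\<^sup>2"
    by (simp add: xi0_def wtilde_def mult.commute)
  also have "cmod \<dots> \<le> cmod (of_real ((cmod w)\<^sup>2)) + cmod ((wtilde w c)\<^sup>2)"
    by (rule norm_triangle_ineq4)
  also have "\<dots> = 2 * (cmod w)\<^sup>2"
    using norm_wtilde[OF assms] by (simp add: norm_power)
  finally show ?thesis .
qed

lemma norm_xi1_le:
  assumes "c \<noteq> 0" "\<rho> \<ge> 0" "cmod w \<le> 1"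
  shows "cmod (xi1 \<rho> w c) \<le> 6 * \<rho> * cmod w"
proof -
  define u where "u = wtilde w c"
  have u: "cmod u = cmod w"
    using norm_wtilde[OF assms(1)] by (simp add: u_def)
  have j: "\<bar>jbracket u\<bar> \<le> 3 / 2"
    using jbracket_minus_1_le[of u] jbracket_ge_1[of u] assms u by simp
  have d: "cmod (u - cnj u) \<le> 2 * cmod w"
    using norm_triangle_ineq4[of u "cnj u"] u by simp
  have "cmod (xi1 \<rho> w c) = 2 * \<rho> * (cmod (u - cnj u) * \<bar>jbracket u\<bar>)"
    using assms by (simp add: xi1_def u_def norm_mult)
  also have "\<dots> \<le> 2 * \<rho> * (2 * cmod w * (3 / 2))"
    using d j assms by (intro mult_left_mono mult_mono) auto
  finally show ?thesis by simp
qed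

section \<open>The control and the denominator \<open>mu\<close> near \<open>w = 0\<close>\<close>

text \<open>The difference is \<open>c/|c|\<close> times a quotient with numerator
  \<open>x1 + s - 2 * cnj x0\<close>. Here \<open>s\<close> and \<open>2 * cnj x0\<close> are both
  close to 4, \<open>x1\<close> is small, and the denominator has modulus at least 2.\<close>

lemma norm_zstar_minus_le:
  assumes c: "c \<noteq> 0" and \<rho>: "\<rho> \<ge> 0" and D: "Delta \<rho> w c > 0" and w: "cmod w \<le> 1/2"
  shows "cmod (zstar \<rho> w c - c / of_real (cmod c)) \<le> (6 * \<rho> + 4) * cmod w"
proof -
  define x0 x1 s where "x0 = xi0 w c" and "x1 = xi1 \<rho> w c" and "s = sqrt (Delta \<rho> w c)"
  have w2: "(cmod w)\<^sup>2 \<le> 1/2 * cmod w"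
    unfolding power2_eq_square using w by (intro mult_right_mono) auto
  have x0: "cmod (x0 - 2) \<le> cmod w"
    using norm_xi0_minus_2_le[OF c, of w] w2 by (simp add: x0_def)
  have x0_ge: "cmod x0 \<ge> 1"
    using norm_triangle_ineq2[of 2 "2 - x0"] x0 w by (simp add: norm_minus_commute)
  have x0_ne: "x0 \<noteq> 0" using x0_ge by auto
  have x1: "cmod x1 \<le> 6 * \<rho> * cmod w"
    using norm_xi1_le[OF c \<rho>, of w] w by (simp add: x1_def)
  have "Re x1 = 0" by (simp add: x1_def xi1_def)
  \<comment> \<open>\<open>x1\<close> is purely imaginary, so its square is minus the square of its
    modulus.\<close>
  then have D': "Delta \<rho> w c = (2 * cmod x0)\<^sup>2 - (cmod x1)\<^sup>2"
    using cmod_power2[of x1] by (simp add: Delta_def x0_def x1_def power_mult_distrib Re_power2)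
  have s2: "s\<^sup>2 = (2 * cmod x0)\<^sup>2 - (cmod x1)\<^sup>2"
    using D D' by (simp add: s_def)
  have s0: "s \<ge> 0" using D by (simp add: s_def)
  have x1_le: "cmod x1 \<le> 2 * cmod x0"
    by (rule power2_le_imp_le) (use s2 zero_le_power2[of s] in auto)
  \<comment> \<open>\<open>s\<close> and \<open>|x1|\<close> are the legs of a right triangle with
    hypotenuse \<open>2|x0|\<close>. A leg is at most the hypotenuse, and the hypotenuse is at most
    the sum of the legs; together this puts \<open>s\<close> within \<open>|x1|\<close> of
    \<open>2|x0|\<close>.\<close>
  have "s \<le> 2 * cmod x0"
    by (rule power2_le_imp_le) (use s2 in auto)
  moreover have "2 * cmod x0 - cmod x1 \<le> s"
  proof (rule power2_le_imp_le[OF _ s0])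
    have "(2 * cmod x0 - cmod x1)\<^sup>2 = s\<^sup>2 - 2 * cmod x1 * (2 * cmod x0 - cmod x1)"
      unfolding s2 by (simp add: power2_eq_square algebra_simps)
    then show "(2 * cmod x0 - cmod x1)\<^sup>2 \<le> s\<^sup>2"
      using x1_le by simp
  qed
  ultimately have s: "\<bar>s - 2 * cmod x0\<bar> \<le> cmod x1" by simp
  have n2: "\<bar>cmod x0 - 2\<bar> \<le> cmod w"
    using norm_triangle_ineq3[of x0 2] x0 by simp
  \<comment> \<open>Telescoping: \<open>s\<close> is compared with \<open>2|x0|\<close>, then
    \<open>2|x0|\<close> with 4, then 4 with \<open>2 * cnj x0\<close>.\<close>
  have "cmod (x1 + of_real s - 2 * cnj x0) =
      cmod (x1 + of_real (s - 2 * cmod x0) + of_real (2 * (cmod x0 - 2)) - 2 * cnj (x0 - 2))"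
    by (simp add: algebra_simps)
  also have "\<dots> \<le> cmod x1 + \<bar>s - 2 * cmod x0\<bar> + 2 * \<bar>cmod x0 - 2\<bar> + 2 * cmod (x0 - 2)"
  proof -
    have "cmod (of_real (s - 2 * cmod x0)) = \<bar>s - 2 * cmod x0\<bar>"
      "cmod (of_real (2 * (cmod x0 - 2))) = 2 * \<bar>cmod x0 - 2\<bar>"
      "cmod (2 * cnj (x0 - 2)) = 2 * cmod (x0 - 2)"
      \<comment> \<open>The restricted simpset keeps each difference whole inside
        \<open>of_real\<close> and \<open>cnj\<close>.\<close>
      by (simp_all only: norm_of_real abs_mult norm_mult complex_mod_cnj norm_numeral abs_numeral)
    then show ?thesis
      using norm_triangle_ineq4[of "x1 + of_real (s - 2 * cmod x0) + of_real (2 * (cmod x0 - 2))"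
          "2 * cnj (x0 - 2)"]
        norm_triangle_ineq[of "x1 + of_real (s - 2 * cmod x0)" "of_real (2 * (cmod x0 - 2))"]
        norm_triangle_ineq[of x1 "of_real (s - 2 * cmod x0)"]
      by linarith
  qed
  also have "\<dots> \<le> 6 * \<rho> * cmod w + 6 * \<rho> * cmod w + 2 * cmod w + 2 * cmod w"
    using order.trans[OF s x1] x1 n2 x0 by (intro add_mono mult_left_mono) auto
  also have "\<dots> = 2 * (6 * \<rho> * cmod w) + 4 * cmod w"
    by simp
  finally have num: "cmod (x1 + of_real s - 2 * cnj x0) \<le> 2 * (6 * \<rho> * cmod w) + 4 * cmod w" .
  have "zstar \<rho> w c - c / of_real (cmod c) =
      c / of_real (cmod c) * ((x1 + of_real s - 2 * cnj x0) / (2 * cnj x0))"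
    using x0_ne by (simp add: zstar_def x0_def x1_def s_def diff_divide_distrib right_diff_distrib)
  also have "cmod \<dots> = cmod (x1 + of_real s - 2 * cnj x0) / (2 * cmod x0)"
    using c by (simp add: norm_mult norm_divide)
  also have "\<dots> \<le> (2 * (6 * \<rho> * cmod w) + 4 * cmod w) / 2"
    using num x0_ge \<rho> by (intro frac_le) auto
  also have "\<dots> \<le> (6 * \<rho> + 4) * cmod w"
    by (simp add: algebra_simps)
  finally show ?thesis .
qed

lemma abs_mu_minus_1_le:
  assumes "\<rho> \<ge> 0" "cmod z = 1" "cmod w \<le> 1"
  shows "\<bar>mu \<rho> w z - 1\<bar> \<le> (1 + \<rho>) * cmod w"
proof -
  have "\<bar>\<rho> * re_pair w z\<bar> \<le> \<rho> * cmod w"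
    using abs_re_pair_le[of w z] assms by (simp add: abs_mult mult_left_mono)
  then show ?thesis
    unfolding mu_def using jbracket_minus_1_le[of w] jbracket_ge_1[of w] assms
    by (simp add: algebra_simps)
qed

text \<open>The radius makes the deviation of \<open>mu\<close> from 1 at most 1/2. A uniform lower
  bound means that division by \<open>mu\<close> costs only a constant factor.\<close>

lemma mu_ge_half:
  assumes "\<rho> \<ge> 0" "cmod z = 1" "cmod w \<le> 1 / (2 * (1 + \<rho>))"
  shows "mu \<rho> w z \<ge> 1/2"
proof -
  have "(1 + \<rho>) * cmod w \<le> 1/2"
    using assms by (simp add: field_simps)
  moreover have "cmod w \<le> 1"
    using assms(1) by (intro order.trans[OF assms(3)]) (simp add: field_simps)
  ultimately show ?thesis
    using abs_mu_minus_1_le[OF assms(1,2), of w] by simp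
qed

section \<open>Leading terms of the three right-hand sides\<close>

text \<open>Replacing \<open>z\<close> by \<open>c/|c|\<close>, \<open>j\<close> and
  \<open>m\<close> by 1, and dropping the summand \<open>w\<close> turns the right-hand side into
  the leading term; each replacement costs \<open>O(|w|)\<close>.\<close>

lemma norm_w_rhs_minus_le:
  assumes c: "c \<noteq> 0" and \<rho>: "\<rho> \<ge> 0" and D: "Delta \<rho> w c > 0"
    and w: "cmod w \<le> 1 / (2 * (1 + \<rho>))"
  shows "cmod (w_rhs \<rho> w c - (- \<i> * of_real \<rho> * (c / of_real (cmod c))))
    \<le> 2 * (1 + \<rho> * (7 * \<rho> + 6)) * cmod w"
proof -
  define z e m j where "z = zstar \<rho> w c" and "e = c / of_real (cmod c)"
    and "m = mu \<rho> w z" and "j = jbracket w"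
  have wh: "cmod w \<le> 1/2"
    using \<rho> by (intro order.trans[OF w]) (simp add: field_simps)
  have z1: "cmod z = 1" using norm_zstar[OF c D] by (simp add: z_def)
  have e1: "cmod e = 1" using c by (simp add: e_def norm_divide)
  have m: "m \<ge> 1/2" using mu_ge_half[OF \<rho> z1 w] by (simp add: m_def)
  have m1: "\<bar>m - 1\<bar> \<le> (1 + \<rho>) * cmod w"
    using abs_mu_minus_1_le[OF \<rho> z1, of w] wh by (simp add: m_def)
  have j1: "\<bar>j - 1\<bar> \<le> cmod w"
    using jbracket_minus_1_le[of w] jbracket_ge_1[of w] wh by (simp add: j_def)
  have ze: "cmod (z - e) \<le> (6 * \<rho> + 4) * cmod w"
    using norm_zstar_minus_le[OF c \<rho> D wh] by (simp add: z_def e_def)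
  \<comment> \<open>Over the common denominator \<open>m\<close> the numerator contains
    \<open>j * z - m * e\<close>, split here as
    \<open>(j - 1) * z + (z - e) - (m - 1) * e\<close>.\<close>
  have "w_rhs \<rho> w c - (- \<i> * of_real \<rho> * e) =
      \<i> * ((w - of_real \<rho> * (of_real (j - 1) * z + (z - e) - of_real (m - 1) * e)) / of_real m)"
    using m by (simp add: w_rhs_def z_def[symmetric] m_def[symmetric] j_def[symmetric] field_simps)
  also have "cmod \<dots> = cmod (w - of_real \<rho> * (of_real (j - 1) * z + (z - e) - of_real (m - 1) * e)) / m"
    using m by (simp add: norm_mult norm_divide del: of_real_diff)
  also have "\<dots> \<le> ((1 + \<rho> * (7 * \<rho> + 6)) * cmod w) / (1/2)"
  proof (rule frac_le)
    have "cmod (of_real (j - 1) * z + (z - e) - of_real (m - 1) * e)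
        \<le> cmod (of_real (j - 1) * z) + cmod (z - e) + cmod (of_real (m - 1) * e)"
      by (rule order.trans[OF norm_triangle_ineq4 add_right_mono[OF norm_triangle_ineq]])
    also have "\<dots> = \<bar>j - 1\<bar> + cmod (z - e) + \<bar>m - 1\<bar>"
      unfolding norm_mult norm_of_real z1 e1 by simp
    \<comment> \<open>The constant is the sum of 1, \<open>6 * \<rho> + 4\<close> and
      \<open>1 + \<rho>\<close>.\<close>
    also have "\<dots> \<le> (7 * \<rho> + 6) * cmod w"
      using j1 ze m1 by (simp add: algebra_simps)
    finally have *: "cmod (of_real (j - 1) * z + (z - e) - of_real (m - 1) * e)
        \<le> (7 * \<rho> + 6) * cmod w" .
    have "cmod (w - of_real \<rho> * (of_real (j - 1) * z + (z - e) - of_real (m - 1) * e))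
        \<le> cmod w + \<rho> * cmod (of_real (j - 1) * z + (z - e) - of_real (m - 1) * e)"
      by (rule order.trans[OF norm_triangle_ineq4]) (use \<rho> in \<open>simp add: norm_mult\<close>)
    also have "\<dots> \<le> cmod w + \<rho> * ((7 * \<rho> + 6) * cmod w)"
      using * \<rho> by (intro add_left_mono mult_left_mono)
    finally show "cmod (w - of_real \<rho> * (of_real (j - 1) * z + (z - e) - of_real (m - 1) * e))
        \<le> (1 + \<rho> * (7 * \<rho> + 6)) * cmod w"
      by (simp add: algebra_simps)
  qed (use m \<rho> in auto)
  finally show ?thesis by (simp add: e_def mult_ac)
qed

text \<open>The part of the error that contains \<open>w\<close> carries the factor
  \<open>jbracket b - 1\<close>, which vanishes with \<open>b\<close>; hence the bound involves
  \<open>|b|\<close> alone.\<close>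

lemma norm_b_rhs_minus_le:
  assumes "cmod w \<le> 1" "cmod b \<le> 1"
  shows "cmod (b_rhs w b - 2 * \<i> * w) \<le> 4 * cmod b"
proof -
  have jb: "\<bar>jbracket b - 1\<bar> \<le> cmod b / 2" and jw: "\<bar>jbracket w\<bar> \<le> 3/2"
    using jbracket_minus_1_le[of b] jbracket_ge_1[of b]
      jbracket_minus_1_le[of w] jbracket_ge_1[of w] assms by simp_all
  have "b_rhs w b - 2 * \<i> * w = 2 * \<i> * (of_real (jbracket b - 1) * w + of_real (jbracket w) * b)"
    by (simp add: b_rhs_def algebra_simps)
  also have "cmod \<dots> = 2 * cmod (of_real (jbracket b - 1) * w + of_real (jbracket w) * b)"
    by (simp only: norm_mult norm_ii norm_numeral mult_1_right)
  also have "\<dots> \<le> 2 * (\<bar>jbracket b - 1\<bar> * cmod w + \<bar>jbracket w\<bar> * cmod b)"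
    using norm_triangle_ineq[of "of_real (jbracket b - 1) * w" "of_real (jbracket w) * b"]
    by (simp only: norm_mult norm_of_real) simp
  also have "\<dots> \<le> 2 * (cmod b / 2 * 1 + 3/2 * cmod b)"
    using jb jw assms by (intro mult_left_mono add_mono mult_mono) auto
  finally show ?thesis by simp
qed

text \<open>The three error terms have separate sources: the control term is linear in
  \<open>c\<close>, the factor \<open>jbracket b - 1\<close> on \<open>w\<close> gives
  \<open>|b|^2 |w|\<close>, and the factor \<open>jbracket w - 1\<close> on \<open>b\<close> gives
  \<open>|b w^2|\<close>. The quadratic bracket bound is essential for the last two.\<close>

lemma norm_c_rhs_minus_le:
  assumes c: "c \<noteq> 0" and \<rho>: "\<rho> \<ge> 0" and D: "Delta \<rho> w c > 0"
    and w: "cmod w \<le> 1 / (2 * (1 + \<rho>))"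
  shows "cmod (c_rhs \<rho> w b c - (- 3 * \<i> * b))
    \<le> (6 * \<bar>1 - \<rho>\<^sup>2\<bar> + 2) * (cmod c + cmod (b * w\<^sup>2) + (cmod b)\<^sup>2 * cmod w)"
proof -
  define z m j x0 where "z = zstar \<rho> w c" and "m = mu \<rho> w z" and "j = jbracket w"
    and "x0 = xi0 w c"
  define P where "P = (1 - \<rho>\<^sup>2) * re_pair (c * x0) z"
  define Q where "Q = 2 * j * m\<^sup>2"
  have wh: "cmod w \<le> 1/2"
    using \<rho> by (intro order.trans[OF w]) (simp add: field_simps)
  have z1: "cmod z = 1" using norm_zstar[OF c D] by (simp add: z_def)
  have m: "m \<ge> 1/2" using mu_ge_half[OF \<rho> z1 w] by (simp add: m_def)
  have j: "j \<ge> 1" "j - 1 \<le> (cmod w)\<^sup>2 / 2"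
    using jbracket_ge_1[of w] jbracket_le[of w] by (simp_all add: j_def)
  have jb: "jbracket b \<ge> 1" "jbracket b - 1 \<le> (cmod b)\<^sup>2 / 2"
    using jbracket_ge_1[of b] jbracket_le[of b] by simp_all
  have "(1/2)\<^sup>2 \<le> m\<^sup>2"
    using m by (intro power_mono) auto
  then have "1 * (1/2)\<^sup>2 \<le> j * m\<^sup>2"
    using j by (intro mult_mono) auto
  then have Q: "Q \<ge> 1/2" by (simp add: Q_def power2_eq_square)
  have "(cmod w)\<^sup>2 \<le> (1/2)\<^sup>2"
    using wh by (intro power_mono) auto
  then have "cmod (x0 - 2) \<le> 1"
    using norm_xi0_minus_2_le[OF c, of w] by (simp add: x0_def power2_eq_square)
  then have x0: "cmod x0 \<le> 3"
    using norm_triangle_ineq[of "x0 - 2" 2] by simp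
  have "\<bar>re_pair (c * x0) z\<bar> \<le> cmod c * 3"
    using abs_re_pair_le[of "c * x0" z] mult_left_mono[OF x0, of "cmod c"] z1
    by (simp add: norm_mult)
  then have P: "\<bar>P\<bar> \<le> \<bar>1 - \<rho>\<^sup>2\<bar> * (cmod c * 3)"
    unfolding P_def abs_mult by (intro mult_left_mono) auto
  \<comment> \<open>The 3 bounds \<open>|x0|\<close>, and \<open>Q\<close> is at least
    \<open>2 * 1 * (1/2)^2\<close>.\<close>
  have "\<bar>P\<bar> / Q \<le> (\<bar>1 - \<rho>\<^sup>2\<bar> * (cmod c * 3)) / (1/2)"
    using P Q by (intro frac_le) auto
  then have PQ: "\<bar>P\<bar> / Q \<le> 6 * \<bar>1 - \<rho>\<^sup>2\<bar> * cmod c" by simp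
  define A where "A = \<i> * of_real P / of_real Q * z"
  define B where "B = of_real (jbracket b - 1) * w"
  define E where "E = of_real (j - 1) * b"
  have A: "cmod A \<le> 6 * \<bar>1 - \<rho>\<^sup>2\<bar> * cmod c"
    using PQ Q by (simp add: A_def norm_mult norm_divide z1)
  have B: "cmod B \<le> (cmod b)\<^sup>2 * cmod w / 2"
    using jb mult_right_mono[OF jb(2), of "cmod w"]
    unfolding B_def norm_mult norm_of_real by simp
  have E: "cmod E \<le> cmod (b * w\<^sup>2) / 2"
    using j mult_right_mono[OF j(2), of "cmod b"]
    unfolding E_def norm_mult norm_of_real norm_power by (simp add: mult.commute)
  have "c_rhs \<rho> w b c - (- 3 * \<i> * b) = A - 3 * (\<i> * (B + E))"
    unfolding c_rhs_def z_def[symmetric] m_def[symmetric] j_def[symmetric] x0_def[symmetric]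
      P_def[symmetric] Q_def[symmetric] A_def[symmetric]
    by (simp add: B_def E_def algebra_simps)
  also have "cmod \<dots> \<le> cmod A + 3 * cmod (B + E)"
    by (rule order.trans[OF norm_triangle_ineq4]) (simp add: norm_mult)
  also have "\<dots> \<le> cmod A + 3 * (cmod B + cmod E)"
    using norm_triangle_ineq[of B E] by simp
  \<comment> \<open>The true factor 3/2 of the last two terms is rounded up to 2.\<close>
  also have "\<dots> \<le> 6 * \<bar>1 - \<rho>\<^sup>2\<bar> * cmod c + 2 * (cmod (b * w\<^sup>2) + (cmod b)\<^sup>2 * cmod w)"
  proof -
    have "0 \<le> cmod (b * w\<^sup>2)" "0 \<le> (cmod b)\<^sup>2 * cmod w" by simp_all
    then show ?thesis
      using A B E unfolding distrib_left by linarith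
  qed
  also have "\<dots> \<le> (6 * \<bar>1 - \<rho>\<^sup>2\<bar> + 2) * (cmod c + cmod (b * w\<^sup>2) + (cmod b)\<^sup>2 * cmod w)"
    by (simp add: algebra_simps)
  finally show ?thesis .
qed

section \<open>Growth orders at 0 from the right\<close>

text \<open>The bootstrap step. The mean value inequality is applied on \<open>[s, t]\<close> with
  \<open>s > 0\<close>, since \<open>f\<close> has only a limit at 0, and then \<open>s\<close>
  tends to 0.\<close>

lemma bigo_power_Suc_of_derivative:
  fixes f :: "real \<Rightarrow> 'a::real_normed_vector"
  assumes T: "T > 0" and f0: "(f \<longlongrightarrow> 0) (at_right 0)"
    and der: "\<And>t. t \<in> {0<..<T} \<Longrightarrow> (f has_vector_derivative f' t) (at t)"
    and O: "(\<lambda>t. norm (f' t)) \<in> O[at_right 0](\<lambda>t::real. t ^ n)"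
  shows "(\<lambda>t. norm (f t)) \<in> O[at_right 0](\<lambda>t::real. t ^ Suc n)"
proof -
  from O obtain C where C: "C > 0"
    and ev: "\<forall>\<^sub>F t in at_right 0. norm (norm (f' t)) \<le> C * norm (t ^ n :: real)"
    by (auto simp: bigo_def)
  then obtain d where d: "d > 0" "\<And>t. 0 < t \<Longrightarrow> t < d \<Longrightarrow> norm (f' t) \<le> C * t ^ n"
    by (auto simp: eventually_at_right_field)
  have *: "norm (f t) \<le> C * t ^ Suc n" if t: "0 < t" "t < min d T" for t
  proof (rule tendsto_upperbound)
    show "((\<lambda>s. norm (f t - f s)) \<longlongrightarrow> norm (f t)) (at_right 0)"
      using tendsto_norm[OF tendsto_diff[OF tendsto_const f0, of "f t"]] by simp
    have "norm (f t - f s) \<le> C * t ^ Suc n" if s: "0 < s" "s < t" for s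
    proof -
      have "norm (f t - f s) \<le> (C * t ^ n) * norm (t - s)"
      proof (rule differentiable_bound)
        show "convex {s..t}" by simp
        show "(f has_derivative (\<lambda>h. h *\<^sub>R f' x)) (at x within {s..t})" if "x \<in> {s..t}" for x
          using der[of x] that s t
          by (auto simp: has_vector_derivative_def intro: has_derivative_at_withinI)
        show "onorm (\<lambda>h. h *\<^sub>R f' x) \<le> C * t ^ n" if "x \<in> {s..t}" for x
        proof (rule onorm_le)
          fix h :: real
          have "norm (f' x) \<le> C * x ^ n" using d(2)[of x] that s t by auto
          also have "\<dots> \<le> C * t ^ n"
            using C that s by (intro mult_left_mono power_mono) auto
          finally show "norm (h *\<^sub>R f' x) \<le> C * t ^ n * norm h"
            by (simp add: mult.commute mult_left_mono)
        qed
      qed (use s in auto)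
      also have "\<dots> \<le> (C * t ^ n) * t"
        using C s t by (intro mult_left_mono) auto
      finally show ?thesis by (simp add: mult_ac)
    qed
    then show "\<forall>\<^sub>F s in at_right 0. norm (f t - f s) \<le> C * t ^ Suc n"
      using t unfolding eventually_at_right_field by blast
  qed simp
  show ?thesis
    by (rule bigoI[where c = C])
      (use * d(1) T in \<open>auto simp: eventually_at_right_field abs_mult intro!: exI[of _ "min d T"]\<close>)
qed

lemma bigo_power_mono_at_right_0:
  assumes "m \<le> n"
  shows "(\<lambda>t::real. t ^ n) \<in> O[at_right 0](\<lambda>t. t ^ m)"
  by (rule bigoI[where c = 1])
    (use assms in \<open>auto simp: eventually_at_right_field power_abs intro!: exI[of _ 1] power_decreasing\<close>)

text \<open>Supplies the bound of order 0 from which the bootstraps start.\<close>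

lemma bigo_1_of_tendsto_0:
  fixes f :: "real \<Rightarrow> 'a::real_normed_vector"
  assumes "(f \<longlongrightarrow> 0) F"
  shows "(\<lambda>t. norm (f t)) \<in> O[F](\<lambda>_. 1 :: real)"
proof (rule bigoI[where c = 1])
  show "\<forall>\<^sub>F t in F. norm (norm (f t)) \<le> 1 * norm (1::real)"
    using tendstoD[OF assms, of 1] by (auto elim: eventually_mono)
qed

lemma eventually_norm_le_of_tendsto_0:
  fixes f :: "real \<Rightarrow> 'a::real_normed_vector"
  assumes "(f \<longlongrightarrow> 0) F" "e > 0"
  shows "\<forall>\<^sub>F t in F. norm (f t) \<le> e"
  using tendstoD[OF assms] by (auto elim: eventually_mono)

section \<open>Derivative estimates and bootstrapping along the solution\<close>

theorem theorem11p1p2: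
  fixes \<rho> t1 :: real and w b c :: "real \<Rightarrow> complex"
  assumes rho_pos: "\<rho> > 0" and t1_pos: "t1 > 0"
    and c_nz: "\<And>t. t \<in> {0<..<t1} \<Longrightarrow> c t \<noteq> 0"
    and Delta_pos: "\<And>t. t \<in> {0<..<t1} \<Longrightarrow> Delta \<rho> (w t) (c t) > 0"
    and mu_pos: "\<And>t. t \<in> {0<..<t1} \<Longrightarrow> mu \<rho> (w t) (zstar \<rho> (w t) (c t)) > 0"
    and ode_w: "\<And>t. t \<in> {0<..<t1} \<Longrightarrow> (w has_vector_derivative w_rhs \<rho> (w t) (c t)) (at t)"
    and ode_b: "\<And>t. t \<in> {0<..<t1} \<Longrightarrow> (b has_vector_derivative b_rhs (w t) (b t)) (at t)"
    and ode_c: "\<And>t. t \<in> {0<..<t1} \<Longrightarrow> (c has_vector_derivative c_rhs \<rho> (w t) (b t) (c t)) (at t)"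
    and ham: "\<And>t. t \<in> {0<..<t1} \<Longrightarrow> hamiltonian \<rho> (w t) (b t) (c t) = 0"
    and ang: "\<And>t. t \<in> {0<..<t1} \<Longrightarrow> angular_momentum (w t) (b t) (c t) = 3"
    and lim_w: "(w \<longlongrightarrow> 0) (at_right 0)"
    and lim_b: "(b \<longlongrightarrow> 0) (at_right 0)"
    and lim_c: "(c \<longlongrightarrow> 0) (at_right 0)"
  shows
    "eq_upto_O (\<lambda>t. vector_derivative w (at t))
       (\<lambda>t. - \<i> * of_real \<rho> * (c t / of_real (cmod (c t)))) (\<lambda>t. cmod (w t)) \<and>
     eq_upto_O (\<lambda>t. vector_derivative b (at t))
       (\<lambda>t. 2 * \<i> * w t) (\<lambda>t. cmod (b t)) \<and>
     eq_upto_O (\<lambda>t. vector_derivative c (at t))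
       (\<lambda>t. - 3 * \<i> * b t)
       (\<lambda>t. cmod (c t) + cmod (b t * (w t)\<^sup>2) + (cmod (b t))\<^sup>2 * cmod (w t)) \<and>
     eq_upto_O (\<lambda>t. cmod (w t)) (\<lambda>t. 0) (\<lambda>t. t) \<and>
     eq_upto_O (\<lambda>t. cmod (b t)) (\<lambda>t. 0) (\<lambda>t. t ^ 2) \<and>
     eq_upto_O (\<lambda>t. cmod (c t)) (\<lambda>t. 0) (\<lambda>t. t ^ 3) \<and>
     eq_upto_O (\<lambda>t. cmod (c t) + cmod (b t * (w t)\<^sup>2) + (cmod (b t))\<^sup>2 * cmod (w t))
       (\<lambda>t. 0) (\<lambda>t. t ^ 3)"
proof -
  define F where "F = at_right (0::real)"
  define S where
    "S = (\<lambda>t. cmod (c t) + cmod (b t * (w t)\<^sup>2) + (cmod (b t))\<^sup>2 * cmod (w t))"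
  define e where "e = (\<lambda>t. - \<i> * of_real \<rho> * (c t / of_real (cmod (c t))))"
  define w' b' c' where "w' = (\<lambda>t. vector_derivative w (at t))"
    and "b' = (\<lambda>t. vector_derivative b (at t))" and "c' = (\<lambda>t. vector_derivative c (at t))"
  have \<rho>: "\<rho> \<ge> 0" using rho_pos by simp
  have dom: "\<forall>\<^sub>F t in F. t \<in> {0<..<t1}"
    using t1_pos by (auto simp: F_def eventually_at_right_field)
  have w'_eq: "w' t = w_rhs \<rho> (w t) (c t)" and b'_eq: "b' t = b_rhs (w t) (b t)"
    and c'_eq: "c' t = c_rhs \<rho> (w t) (b t) (c t)" if "t \<in> {0<..<t1}" for t
    using ode_w[OF that] ode_b[OF that] ode_c[OF that]
    by (simp_all add: w'_def b'_def c'_def vector_derivative_at)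
  have dw: "(w has_vector_derivative w' t) (at t)" and db: "(b has_vector_derivative b' t) (at t)"
    and dc: "(c has_vector_derivative c' t) (at t)" if "t \<in> {0<..<t1}" for t
    using ode_w[OF that] ode_b[OF that] ode_c[OF that] w'_eq[OF that] b'_eq[OF that] c'_eq[OF that]
    by simp_all
  have w_small: "\<forall>\<^sub>F t in F. cmod (w t) \<le> 1 / (2 * (1 + \<rho>))"
    using eventually_norm_le_of_tendsto_0[OF lim_w] rho_pos by (simp add: F_def)
  have w_le_1: "\<forall>\<^sub>F t in F. cmod (w t) \<le> 1" and b_le_1: "\<forall>\<^sub>F t in F. cmod (b t) \<le> 1"
    using eventually_norm_le_of_tendsto_0[OF lim_w, of 1]
      eventually_norm_le_of_tendsto_0[OF lim_b, of 1] by (simp_all add: F_def)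

  \<comment> \<open>The pointwise bounds apply once \<open>t\<close> lies in the domain and
    \<open>w\<close>, \<open>b\<close> are small, which holds eventually by the limits at 0.\<close>
  have est_w: "(\<lambda>t. cmod (w' t - e t)) \<in> O[F](\<lambda>t. cmod (w t))"
    by (rule bigoI, use dom w_small in eventually_elim)
      (use norm_w_rhs_minus_le[OF c_nz \<rho> Delta_pos] in \<open>simp add: w'_eq e_def\<close>)
  have est_b: "(\<lambda>t. cmod (b' t - 2 * \<i> * w t)) \<in> O[F](\<lambda>t. cmod (b t))"
    by (rule bigoI, use dom w_le_1 b_le_1 in eventually_elim)
      (use norm_b_rhs_minus_le in \<open>simp add: b'_eq\<close>)
  have S_nonneg: "S t \<ge> 0" for t by (simp add: S_def)
  have est_c: "(\<lambda>t. cmod (c' t - - 3 * \<i> * b t)) \<in> O[F](S)"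
    by (rule bigoI, use dom w_small in eventually_elim)
      (use norm_c_rhs_minus_le[OF c_nz \<rho> Delta_pos] S_nonneg in \<open>simp add: c'_eq S_def\<close>)

  \<comment> \<open>Reduces the order of a derivative to that of its error and of its leading
    term.\<close>
  have norm_bigo: "(\<lambda>t. cmod (x t)) \<in> O[F](g)"
    if "(\<lambda>t. cmod (x t - y t)) \<in> O[F](g)" "(\<lambda>t. cmod (y t)) \<in> O[F](g)"
    for x y :: "real \<Rightarrow> complex" and g :: "real \<Rightarrow> real"
  proof -
    have "(\<lambda>t. cmod (x t)) \<in> O[F](\<lambda>t. cmod (x t - y t) + cmod (y t))"
      by (rule bigoI[where c = 1]) (use norm_triangle_sub in \<open>auto simp: add.commute intro!: always_eventually\<close>)
    also have "(\<lambda>t. cmod (x t - y t) + cmod (y t)) \<in> O[F](g)"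
      using that by (rule sum_in_bigo)
    finally show ?thesis .
  qed
  have bootstrap: "(\<lambda>t. cmod (f t)) \<in> O[F](\<lambda>t. t ^ Suc n)"
    if "(f \<longlongrightarrow> 0) (at_right 0)"
      "\<And>t. t \<in> {0<..<t1} \<Longrightarrow> (f has_vector_derivative f' t) (at t)"
      "(\<lambda>t. cmod (f' t)) \<in> O[F](\<lambda>t. t ^ n)" for f f' :: "real \<Rightarrow> complex" and n
    using bigo_power_Suc_of_derivative[OF t1_pos that[unfolded F_def]] by (simp add: F_def)

  have "(\<lambda>t. cmod (w' t)) \<in> O[F](\<lambda>t. t ^ 0)"
  proof (rule norm_bigo)
    show "(\<lambda>t. cmod (w' t - e t)) \<in> O[F](\<lambda>t. t ^ 0)"
      using landau_o.big_trans[OF est_w] bigo_1_of_tendsto_0[OF lim_w] by (simp add: F_def)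
    show "(\<lambda>t. cmod (e t)) \<in> O[F](\<lambda>t. t ^ 0)"
      \<comment> \<open>Where \<open>c t = 0\<close> the quotient is 0 by the convention for
        division, so \<open>\<rho>\<close> bounds the modulus for every \<open>t\<close>.\<close>
      by (rule bigoI[where c = \<rho>], rule always_eventually)
        (use \<rho> in \<open>simp add: e_def norm_mult norm_divide\<close>)
  qed
  from bootstrap[OF lim_w dw this] have Ow: "(\<lambda>t. cmod (w t)) \<in> O[F](\<lambda>t. t)" by simp

  \<comment> \<open>The leading term \<open>2iw\<close> is only known to be \<open>O(t)\<close>,
    whence the cap \<open>n \<le> 1\<close>; two rounds from order 0 reach order 2.\<close>
  have step_b: "(\<lambda>t. cmod (b t)) \<in> O[F](\<lambda>t. t ^ Suc n)"
    if n: "n \<le> 1" and b: "(\<lambda>t. cmod (b t)) \<in> O[F](\<lambda>t. t ^ n)" for n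
  proof (rule bootstrap[OF lim_b db norm_bigo])
    show "(\<lambda>t. cmod (b' t - 2 * \<i> * w t)) \<in> O[F](\<lambda>t. t ^ n)"
      using landau_o.big_trans[OF est_b b] .
    show "(\<lambda>t. cmod (2 * \<i> * w t)) \<in> O[F](\<lambda>t. t ^ n)"
      using landau_o.big_trans[OF Ow] bigo_power_mono_at_right_0[OF n]
      by (simp add: F_def norm_mult)
  qed
  have "(\<lambda>t. cmod (b t)) \<in> O[F](\<lambda>t. t ^ 0)"
    using bigo_1_of_tendsto_0[OF lim_b] by (simp add: F_def)
  then have Ob: "(\<lambda>t. cmod (b t)) \<in> O[F](\<lambda>t. t ^ 2)"
    using step_b[of 0] step_b[of 1] by (simp add: numeral_2_eq_2)

  \<comment> \<open>The terms in \<open>b\<close> and \<open>w\<close> are \<open>O(t^4)\<close> and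
    \<open>O(t^5)\<close>, so up to order 3 the order known for \<open>c\<close> decides.\<close>
  have OS: "S \<in> O[F](\<lambda>t. t ^ n)"
    if n: "n \<le> 3" and c: "(\<lambda>t. cmod (c t)) \<in> O[F](\<lambda>t. t ^ n)" for n
  proof -
    have "(\<lambda>t. cmod (b t) * cmod (w t) ^ 2) \<in> O[F](\<lambda>t. t ^ 2 * t ^ 2)"
      by (intro landau_o.big_mult landau_o.big_power Ob Ow)
    then have bww: "(\<lambda>t. cmod (b t * (w t)\<^sup>2)) \<in> O[F](\<lambda>t. t ^ 4)"
      by (simp add: norm_mult norm_power flip: power_add)
    have "(\<lambda>t. cmod (b t) ^ 2 * cmod (w t)) \<in> O[F](\<lambda>t. (t ^ 2) ^ 2 * t)"
      by (intro landau_o.big_mult landau_o.big_power Ob Ow)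
    moreover have "(\<lambda>t::real. (t ^ 2) ^ 2 * t) = (\<lambda>t. t ^ 5)"
      by (simp add: fun_eq_iff power_numeral_reduce)
    ultimately have bbw: "(\<lambda>t. (cmod (b t))\<^sup>2 * cmod (w t)) \<in> O[F](\<lambda>t. t ^ 5)"
      by simp
    have "(\<lambda>t. t ^ k) \<in> O[F](\<lambda>t. t ^ n)" if "k \<ge> 4" for k
      using bigo_power_mono_at_right_0[of n k] n that by (simp add: F_def)
    then show ?thesis
      unfolding S_def by (intro sum_in_bigo c landau_o.big_trans[OF bww] landau_o.big_trans[OF bbw]) auto
  qed
  \<comment> \<open>Now the leading term \<open>-3ib\<close> of order 2 sets the cap; three rounds
    from order 0 reach order 3.\<close>
  have step_c: "(\<lambda>t. cmod (c t)) \<in> O[F](\<lambda>t. t ^ Suc n)"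
    if n: "n \<le> 2" and c: "(\<lambda>t. cmod (c t)) \<in> O[F](\<lambda>t. t ^ n)" for n
  proof (rule bootstrap[OF lim_c dc norm_bigo])
    show "(\<lambda>t. cmod (c' t - - 3 * \<i> * b t)) \<in> O[F](\<lambda>t. t ^ n)"
      using n by (intro landau_o.big_trans[OF est_c] OS c) auto
    show "(\<lambda>t. cmod (- 3 * \<i> * b t)) \<in> O[F](\<lambda>t. t ^ n)"
      using landau_o.big_trans[OF Ob] bigo_power_mono_at_right_0[OF n]
      by (simp add: F_def norm_mult)
  qed
  have "(\<lambda>t. cmod (c t)) \<in> O[F](\<lambda>t. t ^ 0)"
    using bigo_1_of_tendsto_0[OF lim_c] by (simp add: F_def)
  then have Oc: "(\<lambda>t. cmod (c t)) \<in> O[F](\<lambda>t. t ^ 3)"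
    using step_c[of 0] step_c[of 1] step_c[of 2] by (simp add: numeral_2_eq_2 numeral_3_eq_3)
  have OS3: "S \<in> O[F](\<lambda>t. t ^ 3)"
    using OS[OF _ Oc] by simp

  show ?thesis
    using est_w est_b est_c Ow Ob Oc OS3
    unfolding eq_upto_O_iff_bigo F_def w'_def b'_def c'_def e_def S_def by simp
qed

end
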